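(* Let $W_{\psi,\varphi}$ be a densely defined unbounded weighted composition operator on $\mathcal F^2$ induced by two entire functions $\psi\not\equiv 0$ and $\varphi\not\equiv\text{const}$. Suppose that there exists an involutive mapping $S:\mathcal F^2\to\mathcal F^2$ (i.e. $S(Sf)=f$ for all $f\in\mathcal F^2$) such that $$\operatorname{dom}(W_{\psi,\varphi}^* )\subseteq\operatorname{dom}(W_{\psi,\varphi}S)$$ and $$\|W_{\psi,\varphi}Sf\|\le\|W_{\psi,\varphi}^*f\|,\quad\forall f\in\operatorname{dom}(W_{\psi,\varphi}^* ).$$ Then the following conclusions hold. (1) The function $\psi$ never vanishes on $\mathbb C$. Furthermore, if $\psi\in\mathcal F^2$, then it takes the form $\psi(z)=\psi(0)e^{Cz^2+Dz}$, where $C,D$ are complex constants with $|C|<1/2$ and $\psi(0)\ne0$. (2) The function $\varphi$ takes the form $\varphi(z)=Az+B$, where $A,B$ are complex constants with $A\neq0$. (3) If $A=1$ and $S$ is the identity operator, then $\psi(z)=\psi(0)e^{Dz}$, where $D$ is a complex constant, $\psi(0)\ne0$ and $|B|\ge|D|$.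
   Context: The Fock space $\mathcal F^2$ is the Hilbert space of entire functions on $\mathbb C$ that are square integrable with respect to $\frac1\pi e^{-|z|^2}\,dV(z)$ ($dV$ is Lebesgue measure on $\mathbb C$), with inner product $\langle f,g\rangle=\frac1\pi\int_{\mathbb C}f(z)\overline{g(z)}e^{-|z|^2}\,dV(z)$. For entire functions $\psi,\varphi$, put $E(\psi,\varphi)f=\psi\cdot (f\circ\varphi)$. The maximal weighted composition operator $W_{\psi,\varphi,\max}$ has domain $\{f\in\mathcal F^2: E(\psi,\varphi)f\in\mathcal F^2\}$ and acts by $W_{\psi,\varphi,\max}f=E(\psi,\varphi)f$. An unbounded weighted composition operator $W_{\psi,\varphi}$ is the restriction of $W_{\psi,\varphi,\max}$ to some linear subspace $\operatorname{dom}(W_{\psi,\varphi})$ of $\operatorname{dom}(W_{\psi,\varphi,\max})$ ("unbounded" means not necessarily bounded). $\operatorname{dom}(W_{\psi,\varphi}S)=\{f\in\mathcal F^2: Sf\in\operatorname{dom}(W_{\psi,\varphi})\}$, and $W_{\psi,\varphi}^*$ is the Hilbert space adjoint. *)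

theory Defs
  imports "HOL-Complex_Analysis.Complex_Analysis"
begin

definition fock_space :: "(complex \<Rightarrow> complex) set" where
  "fock_space = {f. f holomorphic_on UNIV \<and>
     integrable lborel (\<lambda>z. (cmod (f z))\<^sup>2 * exp (- (cmod z)\<^sup>2))}"

definition fock_inner :: "(complex \<Rightarrow> complex) \<Rightarrow> (complex \<Rightarrow> complex) \<Rightarrow> complex" where
  "fock_inner f g =
     complex_of_real (1 / pi) *
     (LINT z|lborel. f z * cnj (g z) * complex_of_real (exp (- (cmod z)\<^sup>2)))"

definition fock_norm :: "(complex \<Rightarrow> complex) \<Rightarrow> real" where
  "fock_norm f = sqrt (Re (fock_inner f f))"

definition fock_subspace :: "(complex \<Rightarrow> complex) set \<Rightarrow> bool" where
  "fock_subspace D \<longleftrightarrow> D \<subseteq> fock_space \<and> (\<lambda>z. 0) \<in> D \<and>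
     (\<forall>f\<in>D. \<forall>g\<in>D. (\<lambda>z. f z + g z) \<in> D) \<and>
     (\<forall>c. \<forall>f\<in>D. (\<lambda>z. c * f z) \<in> D)"

definition fock_dense :: "(complex \<Rightarrow> complex) set \<Rightarrow> bool" where
  "fock_dense D \<longleftrightarrow>
     (\<forall>f\<in>fock_space. \<forall>e>0. \<exists>g\<in>D. fock_norm (\<lambda>z. f z - g z) < e)"

text \<open>An operator is given by its domain \<open>D\<close> together with its action \<open>T\<close>, whose values
  outside \<open>D\<close> are irrelevant. The description in \<open>adj_op\<close> determines a unique function on
  \<open>adj_dom D T\<close> only when \<open>D\<close> is dense.\<close>

definition adj_dom ::
  "(complex \<Rightarrow> complex) set \<Rightarrow> ((complex \<Rightarrow> complex) \<Rightarrow> complex \<Rightarrow> complex) \<Rightarrow>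
   (complex \<Rightarrow> complex) set" where
  "adj_dom D T = {g \<in> fock_space. \<exists>h\<in>fock_space. \<forall>f\<in>D. fock_inner (T f) g = fock_inner f h}"

definition adj_op ::
  "(complex \<Rightarrow> complex) set \<Rightarrow> ((complex \<Rightarrow> complex) \<Rightarrow> complex \<Rightarrow> complex) \<Rightarrow>
   (complex \<Rightarrow> complex) \<Rightarrow> complex \<Rightarrow> complex" where
  "adj_op D T g =
     (THE h. h \<in> fock_space \<and> (\<forall>f\<in>D. fock_inner (T f) g = fock_inner f h))"

definition wcomp ::
  "(complex \<Rightarrow> complex) \<Rightarrow> (complex \<Rightarrow> complex) \<Rightarrow> (complex \<Rightarrow> complex) \<Rightarrow> complex \<Rightarrow> complex"
  where "wcomp \<psi> \<phi> f = (\<lambda>z. \<psi> z * f (\<phi> z))"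

definition wcomp_max_dom ::
  "(complex \<Rightarrow> complex) \<Rightarrow> (complex \<Rightarrow> complex) \<Rightarrow> (complex \<Rightarrow> complex) set" where
  "wcomp_max_dom \<psi> \<phi> = {f \<in> fock_space. wcomp \<psi> \<phi> f \<in> fock_space}"

definition is_wcomp_dom ::
  "(complex \<Rightarrow> complex) \<Rightarrow> (complex \<Rightarrow> complex) \<Rightarrow> (complex \<Rightarrow> complex) set \<Rightarrow> bool" where
  "is_wcomp_dom \<psi> \<phi> D \<longleftrightarrow> fock_subspace D \<and> D \<subseteq> wcomp_max_dom \<psi> \<phi>"

definition comp_dom ::
  "(complex \<Rightarrow> complex) set \<Rightarrow> ((complex \<Rightarrow> complex) \<Rightarrow> complex \<Rightarrow> complex) \<Rightarrow>
   (complex \<Rightarrow> complex) set" where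
  "comp_dom D S = {f \<in> fock_space. S f \<in> D}"

end

theory Submission
  imports Defs "HOL-Probability.Distributions"
begin

text \<open>
  Write \<open>K w\<close> for the reproducing kernel. Then \<open>W\<^sup>* (K w) = cnj (\<psi> w) K (\<phi> w)\<close>. The hypothesis on
  \<open>S\<close> forces \<open>W\<^sup>*\<close> to be injective: if \<open>W\<^sup>* g = 0\<close> then \<open>W (S g) = 0\<close>, hence \<open>S g = 0 = S 0\<close> and
  \<open>g = 0\<close>. So \<open>\<psi>\<close> has no zeros, and \<open>\<phi> a = \<phi> b\<close> with \<open>a \<noteq> b\<close> would put a nontrivial combination of
  \<open>K a\<close> and \<open>K b\<close> into the kernel; an injective entire function is affine. If \<open>\<psi>\<close> lies in the Fock
  space, the pointwise bound \<open>\<bar>\<psi> z\<bar> \<le> \<parallel>\<psi>\<parallel> exp (\<bar>z\<bar>\<^sup>2 / 2)\<close> makes its logarithm a quadratic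
  polynomial, and decay of \<open>\<bar>\<psi> z\<bar> exp (- \<bar>z\<bar>\<^sup>2 / 2)\<close> at infinity bounds the leading coefficient. For
  \<open>\<phi> z = z + B\<close> and \<open>S = id\<close>, combining \<open>\<parallel>W (K w)\<parallel> \<le> \<bar>\<psi> w\<bar> \<parallel>K (w + B)\<parallel>\<close> with the pointwise bound
  for \<open>W (K w)\<close> at \<open>w + h\<close> gives \<open>Re (2 C w h + C h\<^sup>2 + E h) - \<bar>h\<bar>\<^sup>2 / 2 \<le> \<bar>B\<bar>\<^sup>2 / 2\<close> for all \<open>w\<close> and
  \<open>h\<close>. Unboundedness in \<open>w\<close> excludes \<open>C \<noteq> 0\<close>, and \<open>h = cnj E\<close> yields \<open>\<bar>E\<bar> \<le> \<bar>B\<bar>\<close>.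
\<close>

section \<open>Lebesgue measure on the complex plane\<close>

text \<open>Lebesgue measure is determined by its values on boxes. This identification makes Fubini
  in the real and imaginary parts available.\<close>

lemma lborel_complex:
  "(lborel :: complex measure) = distr (lborel \<Otimes>\<^sub>M lborel) borel (\<lambda>(x, y). Complex x y)"
proof (rule lborel_eqI)
  have m [measurable]: "(\<lambda>(x, y). Complex x y) \<in> borel_measurable (lborel \<Otimes>\<^sub>M lborel)"
    unfolding Complex_eq by measurable
  fix l u :: complex assume le: "\<And>b. b \<in> Basis \<Longrightarrow> l \<bullet> b \<le> u \<bullet> b"
  have le': "Re l \<le> Re u" "Im l \<le> Im u"
    using le[of 1] le[of \<i>] by (auto simp: Basis_complex_def)
  have "(\<lambda>(x, y). Complex x y) -` box l u \<inter> space (lborel \<Otimes>\<^sub>M lborel) =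
        box (Re l) (Re u) \<times> box (Im l) (Im u)"
    by (auto simp: box_def Basis_complex_def space_pair_measure)
  then show "emeasure (distr (lborel \<Otimes>\<^sub>M lborel) borel (\<lambda>(x, y). Complex x y)) (box l u) =
      ennreal (\<Prod>b\<in>Basis. (u - l) \<bullet> b)"
    using le' by (simp add: emeasure_distr lborel.emeasure_pair_measure_Times Basis_complex_def
        ennreal_mult)
qed simp

text \<open>The order of integration matters: a shear in the real direction translates the inner
  variable for each fixed imaginary part. Shears in the imaginary direction use the other
  order.\<close>

lemma nn_integral_complex_Im_Re:
  assumes [measurable]: "g \<in> borel_measurable borel"
  shows "(\<integral>\<^sup>+z. g z \<partial>lborel) = (\<integral>\<^sup>+y. \<integral>\<^sup>+x. g (Complex x y) \<partial>lborel \<partial>lborel)"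
proof -
  have [measurable]: "(\<lambda>(x, y). Complex x y) \<in> borel_measurable (lborel \<Otimes>\<^sub>M lborel)"
    unfolding Complex_eq by measurable
  have "(\<integral>\<^sup>+z. g z \<partial>lborel) = (\<integral>\<^sup>+p. g (case p of (x, y) \<Rightarrow> Complex x y) \<partial>(lborel \<Otimes>\<^sub>M lborel))"
    by (subst lborel_complex) (simp add: nn_integral_distr)
  also have "\<dots> = (\<integral>\<^sup>+y. \<integral>\<^sup>+x. g (Complex x y) \<partial>lborel \<partial>lborel)"
    by (subst lborel_pair.nn_integral_snd [symmetric]) (simp_all add: split_beta)
  finally show ?thesis .
qed

lemma nn_integral_complex_Re_Im:
  assumes [measurable]: "g \<in> borel_measurable borel"
  shows "(\<integral>\<^sup>+z. g z \<partial>lborel) = (\<integral>\<^sup>+x. \<integral>\<^sup>+y. g (Complex x y) \<partial>lborel \<partial>lborel)"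
proof -
  have [measurable]: "(\<lambda>(x, y). Complex x y) \<in> borel_measurable (lborel \<Otimes>\<^sub>M lborel)"
    unfolding Complex_eq by measurable
  have "(\<integral>\<^sup>+z. g z \<partial>lborel) = (\<integral>\<^sup>+p. g (case p of (x, y) \<Rightarrow> Complex x y) \<partial>(lborel \<Otimes>\<^sub>M lborel))"
    by (subst lborel_complex) (simp add: nn_integral_distr)
  also have "\<dots> = (\<integral>\<^sup>+x. \<integral>\<^sup>+y. g (Complex x y) \<partial>lborel \<partial>lborel)"
    by (subst lborel.nn_integral_fst [symmetric]) (simp_all add: split_beta)
  finally show ?thesis .
qed

lemma distr_lborel_eqI_nn_integral:
  fixes T :: "'a::euclidean_space \<Rightarrow> 'a"
  assumes [measurable]: "T \<in> borel_measurable borel"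
    and "\<And>g. g \<in> borel_measurable borel \<Longrightarrow> (\<integral>\<^sup>+z. g (T z) \<partial>lborel) = (\<integral>\<^sup>+z. g z \<partial>lborel)"
  shows "distr lborel borel T = lborel"
proof (rule measure_eqI)
  fix X assume "X \<in> sets (distr lborel borel T)"
  then have X [measurable]: "X \<in> sets borel" by simp
  then show "emeasure (distr lborel borel T) X = emeasure lborel X"
    using assms(2)[of "indicator X"]
    by (simp add: nn_integral_indicator[symmetric] nn_integral_distr del: nn_integral_indicator)
qed simp

lemma nn_integral_lborel_shift:
  fixes g :: "'a::euclidean_space \<Rightarrow> ennreal"
  assumes [measurable]: "g \<in> borel_measurable borel"
  shows "(\<integral>\<^sup>+x. g (x + a) \<partial>lborel) = (\<integral>\<^sup>+x. g x \<partial>lborel)"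
  using nn_integral_distr[of "(+) a" lborel borel g] lborel_distr_plus[of a]
  by (simp add: add.commute[of _ a])

text \<open>On each horizontal line the map is a translation, so the inner integral does not
  change.\<close>

lemma distr_lborel_shear_Re:
  "distr lborel borel (\<lambda>z. z + complex_of_real (a * Im z)) = lborel"
proof (rule distr_lborel_eqI_nn_integral)
  fix g :: "complex \<Rightarrow> ennreal" assume [measurable]: "g \<in> borel_measurable borel"
  have [measurable]: "(\<lambda>x. Complex x y) \<in> borel_measurable borel" for y
    unfolding Complex_eq by measurable
  have "(\<integral>\<^sup>+x. g (Complex (x + a * y) y) \<partial>lborel) = (\<integral>\<^sup>+x. g (Complex x y) \<partial>lborel)" for y
    by (rule nn_integral_lborel_shift[where g = "\<lambda>x. g (Complex x y)"]) measurable
  moreover have "Complex x y + complex_of_real (a * y) = Complex (x + a * y) y" for x y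
    by (simp add: complex_eq_iff)
  ultimately show "(\<integral>\<^sup>+z. g (z + complex_of_real (a * Im z)) \<partial>lborel) = (\<integral>\<^sup>+z. g z \<partial>lborel)"
    by (simp add: nn_integral_complex_Im_Re del: of_real_mult)
qed measurable

lemma distr_lborel_shear_Im:
  "distr lborel borel (\<lambda>z. z + \<i> * complex_of_real (a * Re z)) = lborel"
proof (rule distr_lborel_eqI_nn_integral)
  fix g :: "complex \<Rightarrow> ennreal" assume [measurable]: "g \<in> borel_measurable borel"
  have [measurable]: "Complex x \<in> borel_measurable borel" for x
    unfolding Complex_eq[abs_def] by measurable
  have "(\<integral>\<^sup>+y. g (Complex x (y + a * x)) \<partial>lborel) = (\<integral>\<^sup>+y. g (Complex x y) \<partial>lborel)" for x
    by (rule nn_integral_lborel_shift[where g = "\<lambda>y. g (Complex x y)"]) measurable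
  moreover have "Complex x y + \<i> * complex_of_real (a * x) = Complex x (y + a * x)" for x y
    by (simp add: complex_eq_iff)
  ultimately show "(\<integral>\<^sup>+z. g (z + \<i> * complex_of_real (a * Re z)) \<partial>lborel) = (\<integral>\<^sup>+z. g z \<partial>lborel)"
    by (simp add: nn_integral_complex_Re_Im del: of_real_mult)
qed measurable

lemma distr_lborel_compose:
  fixes T U :: "'a::euclidean_space \<Rightarrow> 'a"
  assumes "distr lborel borel T = lborel" "distr lborel borel U = lborel"
    and [measurable]: "T \<in> borel_measurable borel" "U \<in> borel_measurable borel"
  shows "distr lborel borel (\<lambda>z. T (U z)) = lborel"
proof -
  have "distr lborel borel (\<lambda>z. T (U z)) = distr (distr lborel borel U) borel T"
    by (subst distr_distr) (auto simp: comp_def)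
  with assms show ?thesis by simp
qed

text \<open>A rotation by an angle other than \<open>\<pi>\<close> is a product of three shears.\<close>

lemma distr_lborel_rotation:
  assumes "cmod c = 1"
  shows "distr lborel borel (\<lambda>z. c * z) = lborel"
proof -
  have main: "distr lborel borel (\<lambda>z. d * z) = lborel" if d: "cmod d = 1" "d \<noteq> -1" for d
  proof -
    have sq: "(Re d)\<^sup>2 + (Im d)\<^sup>2 = 1"
      using d(1) by (metis cmod_power2 one_power2)
    have p: "1 + Re d \<noteq> 0"
    proof
      assume "1 + Re d = 0"
      then have "Re d = -1" by simp
      with sq have "Im d = 0" by simp
      with \<open>Re d = -1\<close> d(2) show False by (simp add: complex_eq_iff)
    qed
    \<comment> \<open>For \<open>d\<close> of argument \<theta> this is -tan(\<theta>/2), the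
      coefficient that makes \<open>P\<close>, \<open>Q\<close>, \<open>P\<close> compose to the
      rotation matrix when \<open>Q\<close> has coefficient sin \<theta>. The denominator vanishes
      only at \<open>d = -1\<close>.\<close>
    define a where "a = - Im d / (1 + Re d)"
    define P where "P = (\<lambda>z. z + complex_of_real (a * Im z))"
    define Q where "Q = (\<lambda>z. z + \<i> * complex_of_real (Im d * Re z))"
    have [measurable]: "P \<in> borel_measurable borel" "Q \<in> borel_measurable borel"
      unfolding P_def Q_def by measurable
    have P: "distr lborel borel P = lborel" and Q: "distr lborel borel Q = lborel"
      unfolding P_def Q_def by (rule distr_lborel_shear_Re, rule distr_lborel_shear_Im)
    have aq: "a * Im d = Re d - 1"
      using p sq by (simp add: a_def field_simps power2_eq_square)
    have a2: "a * (1 + Re d) = - Im d"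
      using p by (simp add: a_def)
    have "P (Q (P z)) = d * z" for z
    proof (rule complex_eqI)
      have "Re (P (Q (P z))) = Re z + a * Im z + a * (Im z + Im d * (Re z + a * Im z))"
        by (simp add: P_def Q_def)
      also have "\<dots> = Re z * (1 + a * Im d) + Im z * (a * (1 + 1 + a * Im d))"
        by (simp add: algebra_simps)
      also have "\<dots> = Re (d * z)"
        unfolding aq using a2 by (simp add: algebra_simps)
      finally show "Re (P (Q (P z))) = Re (d * z)" .
      have "Im (P (Q (P z))) = Im z * (1 + a * Im d) + Im d * Re z"
        by (simp add: P_def Q_def algebra_simps)
      then show "Im (P (Q (P z))) = Im (d * z)"
        unfolding aq by (simp add: algebra_simps)
    qed
    then have "(\<lambda>z. d * z) = (\<lambda>z. P (Q (P z)))" by auto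
    moreover have "distr lborel borel (\<lambda>z. P (Q (P z))) = lborel"
      by (intro distr_lborel_compose[of P "\<lambda>z. Q (P z)"] distr_lborel_compose[of Q P] P Q) measurable
    ultimately show ?thesis by simp
  qed
  show ?thesis
  proof (cases "c = -1")
    case True
    \<comment> \<open>The excluded half turn is the square of a quarter turn.\<close>
    have i: "distr lborel borel (\<lambda>z. \<i> * z) = lborel"
      by (rule main) (auto simp: complex_eq_iff)
    have "distr lborel borel (\<lambda>z. \<i> * (\<i> * z)) = lborel"
      by (rule distr_lborel_compose[OF i i]) measurable
    with True show ?thesis by (simp flip: mult.assoc)
  qed (use main assms in auto)
qed

section \<open>Rotation averages and the Gaussian integral\<close>

lemma lborel_integral_rotation:
  fixes g :: "complex \<Rightarrow> 'b::{banach, second_countable_topology}"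
  assumes "cmod c = 1" and [measurable]: "g \<in> borel_measurable borel"
  shows "(\<integral>z. g (c * z) \<partial>lborel) = (\<integral>z. g z \<partial>lborel)"
  using integral_distr[of "\<lambda>z. c * z" lborel borel g] distr_lborel_rotation[OF assms(1)] by simp

lemma lborel_integrable_rotation:
  fixes g :: "complex \<Rightarrow> 'b::{banach, second_countable_topology}"
  assumes "cmod c = 1" and [measurable]: "g \<in> borel_measurable borel" and "integrable lborel g"
  shows "integrable lborel (\<lambda>z. g (c * z))"
  using integrable_distr_eq[of "\<lambda>z. c * z" lborel borel g] distr_lborel_rotation[OF assms(1)] assms(3)
  by simp

text \<open>Cauchy's formula at \<open>0\<close> for \<open>u \<mapsto> F (u * z)\<close> on the
  unit circle. Scaling by \<open>z\<close> instead of varying the radius covers \<open>z = 0\<close>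
  as well.\<close>

lemma has_integral_circle_mean:
  assumes F: "F holomorphic_on UNIV"
  shows "((\<lambda>t. F (exp (2 * of_real pi * \<i> * of_real t) * z)) has_integral F 0) {0..1}"
proof -
  have unit_circle: "circlepath 0 1 t = exp (2 * of_real pi * \<i> * of_real t)" for t
    by (simp add: circlepath)
  have "(\<lambda>u. F (u * z)) holomorphic_on cball 0 1"
    by (rule holomorphic_on_compose_gen[of _ _ F UNIV, unfolded comp_def])
      (auto intro!: holomorphic_intros F)
  then have "((\<lambda>u. F (u * z) / (u - 0)) has_contour_integral (2 * of_real pi * \<i> * F (0 * z))) (circlepath 0 1)"
    by (rule Cauchy_integral_circlepath_simple) simp
  then have "((\<lambda>t. 2 * of_real pi * \<i> * F (exp (2 * of_real pi * \<i> * of_real t) * z))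
      has_integral 2 * of_real pi * \<i> * F 0) {0..1}"
    unfolding has_contour_integral_def
    by (rule has_integral_eq_rhs[OF has_integral_eq[rotated]])
       (auto simp: vector_derivative_circlepath01 unit_circle)
  from has_integral_mult_right[OF this, of "1 / (2 * of_real pi * \<i>)"] show ?thesis
    by simp
qed

text \<open>Averaging over all rotations replaces \<open>F\<close> by its mean over circles, which is \<open>F 0\<close>; this
  takes the place of polar coordinates.\<close>

lemma integral_radial_mult_holomorphic:
  assumes F: "F holomorphic_on UNIV"
    and [measurable]: "\<rho> \<in> borel_measurable borel"
    and rad: "\<And>c z. cmod c = 1 \<Longrightarrow> \<rho> (c * z) = \<rho> z"
    and int: "integrable lborel \<rho>" "integrable lborel (\<lambda>z. F z * complex_of_real (\<rho> z))"
  shows "(\<integral>z. F z * complex_of_real (\<rho> z) \<partial>lborel) = F 0 * complex_of_real (\<integral>z. \<rho> z \<partial>lborel)"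
proof -
  have cF: "continuous_on UNIV F" by (rule holomorphic_on_imp_continuous_on[OF F])
  then have [measurable]: "F \<in> borel_measurable borel"
    by (rule borel_measurable_continuous_onI)
  define g where "g = (\<lambda>z. F z * complex_of_real (\<rho> z))"
  have [measurable]: "g \<in> borel_measurable borel" unfolding g_def by measurable
  define e where "e = (\<lambda>t::real. exp (2 * of_real pi * \<i> * of_real t))"
  have [measurable]: "e \<in> borel_measurable borel" unfolding e_def by measurable
  have e1: "cmod (e t) = 1" for t by (simp add: e_def norm_exp_eq_Re)
  \<comment> \<open>The indicator turns the average over angles into an integral over the whole
    line, so that Fubini for \<open>lborel\<close> applies.\<close>
  define f where "f = (\<lambda>t z. indicator {0..1::real} t *\<^sub>R g (e t * z))"
  have gint: "integrable lborel g" using int(2) by (simp add: g_def)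
  have ig: "integrable lborel (\<lambda>z. g (e t * z))" "(\<integral>z. g (e t * z) \<partial>lborel) = (\<integral>z. g z \<partial>lborel)"
    "(\<integral>z. norm (g (e t * z)) \<partial>lborel) = (\<integral>z. norm (g z) \<partial>lborel)" for t
    using e1[of t] gint by (auto intro: lborel_integrable_rotation lborel_integral_rotation
        lborel_integral_rotation[where g = "\<lambda>z. norm (g z)"])
  have "integrable (lborel \<Otimes>\<^sub>M lborel) (case_prod f)"
  proof (rule lborel_pair.Fubini_integrable)
    show "case_prod f \<in> borel_measurable (lborel \<Otimes>\<^sub>M lborel)"
      unfolding f_def by measurable
    show "integrable lborel (\<lambda>x. \<integral>y. norm (case (x, y) of (t, z) \<Rightarrow> f t z) \<partial>lborel)"
      by (simp add: f_def ig)
    show "AE x in lborel. integrable lborel (\<lambda>y. case (x, y) of (t, z) \<Rightarrow> f t z)"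
      by (simp add: f_def ig)
  qed
  \<comment> \<open>Integrating over \<open>z\<close> first gives the integral of \<open>g\<close>
    by rotation invariance; integrating over \<open>t\<close> first gives circle means, that is
    \<open>F 0\<close> times the weight.\<close>
  then have "(\<integral>z. (\<integral>t. f t z \<partial>lborel) \<partial>lborel) = (\<integral>t. (\<integral>z. f t z \<partial>lborel) \<partial>lborel)"
    by (rule lborel_pair.Fubini_integral)
  also have "\<dots> = (\<integral>z. g z \<partial>lborel)"
    by (simp add: f_def ig)
  also have "(\<lambda>z. \<integral>t. f t z \<partial>lborel) = (\<lambda>z. F 0 * complex_of_real (\<rho> z))"
  proof
    fix z
    have co: "continuous_on {0..1} (\<lambda>t. F (e t * z))"
      unfolding e_def by (intro continuous_on_compose2[OF cF] continuous_intros) auto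
    have "(\<integral>t. indicator {0..1} t *\<^sub>R F (e t * z) \<partial>lborel) = integral {0..1} (\<lambda>t. F (e t * z))"
      using set_borel_integral_eq_integral(2)[OF borel_integrable_atLeastAtMost'[OF co]]
      by (simp add: set_lebesgue_integral_def)
    also have "\<dots> = F 0"
      using has_integral_circle_mean[OF F, of z] by (auto simp: e_def)
    finally have *: "(\<integral>t. indicator {0..1} t *\<^sub>R F (e t * z) \<partial>lborel) = F 0" .
    have "(\<integral>t. f t z \<partial>lborel) = (\<integral>t. (indicator {0..1} t *\<^sub>R F (e t * z)) * complex_of_real (\<rho> z) \<partial>lborel)"
      by (simp add: f_def g_def rad[OF e1])
    then show "(\<integral>t. f t z \<partial>lborel) = F 0 * complex_of_real (\<rho> z)"
      by (simp only: integral_mult_left_zero *)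
  qed
  finally show ?thesis by (simp add: g_def)
qed

lemma gaussian_complex:
  "has_bochner_integral lborel (\<lambda>z::complex. exp (- (cmod z)\<^sup>2)) pi"
proof (rule has_bochner_integral_nn_integral)
  have *: "(\<integral>\<^sup>+x. ennreal (exp (- x\<^sup>2)) \<partial>lborel) = ennreal (sqrt pi)"
    using has_bochner_integral_even_function[OF gaussian_moment_0]
    by (subst nn_integral_eq_integral) (auto simp: has_bochner_integral_iff)
  have [measurable]: "(\<lambda>z::complex. ennreal (exp (- (cmod z)\<^sup>2))) \<in> borel_measurable borel"
    by measurable
  have "(\<integral>\<^sup>+z. ennreal (exp (- (cmod z)\<^sup>2)) \<partial>lborel) =
     (\<integral>\<^sup>+x. \<integral>\<^sup>+y. ennreal (exp (- x\<^sup>2)) * ennreal (exp (- y\<^sup>2)) \<partial>lborel \<partial>lborel)"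
    by (subst nn_integral_complex_Re_Im) (auto simp: cmod_power2 exp_add[symmetric] simp flip: ennreal_mult)
  also have "\<dots> = ennreal (sqrt pi) * ennreal (sqrt pi)"
    by (simp add: nn_integral_cmult nn_integral_multc *)
  also have "\<dots> = ennreal pi" by (simp flip: ennreal_mult)
  finally show "(\<integral>\<^sup>+z. ennreal (exp (- (cmod z)\<^sup>2)) \<partial>lborel) = ennreal pi" .
qed auto

section \<open>Entire functions\<close>

lemma tendsto_at_infinity_imp_constant:
  assumes "f holomorphic_on UNIV" and "(f \<longlongrightarrow> l) at_infinity"
  shows "f constant_on UNIV"
  unfolding constant_on_def using Liouville_weak[OF assms] by (intro exI[of _ l]) simp

lemma nonvanishing_polynomial_imp_constant:
  fixes a :: "nat \<Rightarrow> complex"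
  assumes "\<And>z. (\<Sum>i\<le>n. a i * z ^ i) \<noteq> 0"
  shows "\<forall>i\<in>{1..n}. a i = 0"
proof (rule ccontr)
  assume "\<not> (\<forall>i\<in>{1..n}. a i = 0)"
  then have "a 0 = 0 \<or> (\<exists>i\<in>{1..n}. a i \<noteq> 0)" by blast
  then show False by (rule fundamental_theorem_of_algebra) (use assms in simp)
qed

text \<open>An essential singularity at infinity would contradict injectivity by the great Picard
  theorem, so \<open>f\<close> is a polynomial. Its derivative has no zeros, hence is a nonzero
  constant.\<close>

lemma injective_entire_imp_affine:
  assumes hol: "f holomorphic_on UNIV" and inj: "inj f"
  obtains A B where "A \<noteq> 0" "\<And>z. f z = A * z + B"
proof -
  have nc: "\<not> f constant_on UNIV"
  proof
    assume "f constant_on UNIV"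
    then obtain y where "\<And>x. f x = y" unfolding constant_on_def by blast
    then have "f 0 = f 1" by simp
    then show False using injD[OF inj, of 0 1] by simp
  qed
  define g where "g = (\<lambda>z. f (inverse z))"
  have holg: "g holomorphic_on (UNIV - {0})"
    unfolding g_def by (rule holomorphic_on_compose_gen[of _ _ f UNIV, unfolded comp_def])
      (auto intro!: holomorphic_intros hol)
  have "\<exists>l. ((inverse \<circ> f) \<longlongrightarrow> l) at_infinity"
  proof (rule ccontr)
    assume non: "\<nexists>l. ((inverse \<circ> f) \<longlongrightarrow> l) at_infinity"
    \<comment> \<open>Picard needs both a finite limit and a pole of \<open>g\<close> at
      \<open>0\<close> excluded: the first by Liouville, the second by \<open>non\<close>.\<close>
    obtain a where a: "\<And>w. w \<noteq> a \<Longrightarrow> infinite {x. x \<in> UNIV - {0} \<and> g x = w}"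
    proof (rule great_Picard_infinite[OF open_UNIV UNIV_I holg])
      show "\<not> (g \<longlongrightarrow> l) (at 0)" for l
        using tendsto_at_infinity_imp_constant[OF hol, of l] nc
        by (auto simp: lim_at_infinity_0 g_def comp_def)
      show "\<not> ((inverse \<circ> g) \<longlongrightarrow> l) (at 0)" for l
        using non by (simp add: g_def comp_def lim_at_infinity_0)
    qed auto
    have "{x. x \<in> UNIV - {0} \<and> g x = w} \<subseteq> {inverse (inv f w)}" for w
        using inj by (auto simp: g_def)
    then have "finite {x. x \<in> UNIV - {0} \<and> g x = w}" for w
      by (rule finite_subset) simp
    with a[of "a + 1"] show False by simp
  qed
  then obtain l where "((inverse \<circ> f) \<longlongrightarrow> l) at_infinity" by blast
  then obtain a n where f: "\<And>z. f z = (\<Sum>i\<le>n. a i * z ^ i)"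
    using pole_at_infinity[OF hol] by blast
  have d0: "deriv f z \<noteq> 0" for z
    using holomorphic_injective_imp_regular[OF hol open_UNIV] inj by auto
  have fd: "f = (\<lambda>z. \<Sum>i\<le>n. a i * z ^ i)" using f by auto
  have derivf: "deriv f z = (\<Sum>i\<le>n. a i * (of_nat i * z ^ (i - 1)))" for z
    unfolding fd by (rule DERIV_imp_deriv) (auto intro!: derivative_eq_intros sum.cong)
  \<comment> \<open>The case \<open>n = 0\<close> would make the derivative vanish.\<close>
  obtain m where m: "n = Suc m"
    using d0[of 0] derivf[of 0] by (cases n) auto
  have deq: "deriv f z = (\<Sum>i\<le>m. (of_nat (Suc i) * a (Suc i)) * z ^ i)" for z
    unfolding derivf m by (subst sum.atMost_Suc_shift) (simp add: mult_ac)
  have "\<forall>i\<in>{1..m}. of_nat (Suc i) * a (Suc i) = 0"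
    using d0 deq
    by (intro nonvanishing_polynomial_imp_constant) metis
  then have a0: "a (Suc i) = 0" if "i \<in> {1..m}" for i
    using that by (metis mult_eq_0_iff of_nat_neq_0)
  have "f z = a 1 * z + a 0" for z
  proof -
    have "f z = a 0 + (\<Sum>i\<le>m. a (Suc i) * z ^ Suc i)"
      unfolding f m by (subst sum.atMost_Suc_shift) simp
    also have "(\<Sum>i\<le>m. a (Suc i) * z ^ Suc i) = (\<Sum>i\<in>{0}. a (Suc i) * z ^ Suc i)"
      by (rule sum.mono_neutral_right) (auto simp: a0)
    finally show ?thesis by simp
  qed
  moreover have "a 1 \<noteq> 0"
    using calculation injD[OF inj, of 0 1] by auto
  ultimately show ?thesis using that by blast
qed

text \<open>\<open>h / (2A - h)\<close> maps the disc of radius \<open>R\<close> to the unit disc, so the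
  Schwarz lemma applies.\<close>

lemma Borel_Caratheodory:
  assumes hol: "h holomorphic_on UNIV" and "h 0 = 0" and "A > 0" "R > 0"
    and Re: "\<And>z. cmod z < R \<Longrightarrow> Re (h z) < A" and z: "cmod z \<le> R / 2"
  shows "cmod (h z) \<le> 2 * A"
proof -
  define k where "k = (\<lambda>u. h (of_real R * u) / (2 * of_real A - h (of_real R * u)))"
  have Ru: "Re (h (of_real R * u)) < A" if "cmod u < 1" for u
    using that assms by (intro Re) (simp add: norm_mult)
  have nz: "2 * of_real A - h (of_real R * u) \<noteq> 0" if "cmod u < 1" for u
  proof
    assume "2 * of_real A - h (of_real R * u) = 0"
    then have "h (of_real R * u) = of_real (2 * A)" by simp
    with Ru[OF that] \<open>A > 0\<close> show False by simp
  qed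
  have holh: "(\<lambda>u. h (of_real R * u)) holomorphic_on ball 0 1"
    using holomorphic_on_compose_gen[of "\<lambda>u. of_real R * u" "ball 0 1" h UNIV] hol
    by (auto simp: comp_def intro!: holomorphic_intros)
  have holk: "k holomorphic_on ball 0 1"
    unfolding k_def using nz by (intro holomorphic_intros holh) auto
  have k1: "cmod (k u) < 1" if "cmod u < 1" for u
  proof -
    let ?w = "h (of_real R * u)"
    \<comment> \<open>Geometrically, \<open>Re ?w < A\<close> says that \<open>?w\<close> is nearer
      to \<open>0\<close> than to \<open>2 * A\<close>.\<close>
    have "(2 * A - Re ?w)\<^sup>2 - (Re ?w)\<^sup>2 = 4 * A * (A - Re ?w)"
      by (simp add: power2_eq_square algebra_simps)
    moreover have "4 * A * (A - Re ?w) > 0"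
      using Ru[OF that] \<open>A > 0\<close> by simp
    ultimately have "(cmod ?w)\<^sup>2 < (cmod (2 * of_real A - ?w))\<^sup>2"
      by (simp add: cmod_power2)
    then have "cmod ?w < cmod (2 * of_real A - ?w)"
      by (rule power2_less_imp_less) simp
    with nz[OF that] show ?thesis by (simp add: k_def norm_divide)
  qed
  define u where "u = z / of_real R"
  have u: "cmod u \<le> 1 / 2" using z \<open>R > 0\<close> by (simp add: u_def norm_divide field_simps)
  have Rz: "of_real R * u = z" using \<open>R > 0\<close> by (simp add: u_def)
  have "cmod (k u) \<le> cmod u"
    by (rule Schwarz_Lemma(1)[OF holk]) (use k1 u assms in \<open>auto simp: k_def\<close>)
  then have "cmod (k u) \<le> 1 / 2" using u by simp
  then have "cmod (h z) \<le> cmod (2 * of_real A - h z) / 2"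
    using nz[of u] u by (simp add: k_def norm_divide Rz divide_simps)
  also have "\<dots> \<le> (2 * A + cmod (h z)) / 2"
    using norm_triangle_ineq4[of "2 * of_real A" "h z"] \<open>A > 0\<close> by (simp add: norm_mult)
  finally show ?thesis by simp
qed

text \<open>Borel-Caratheodory on a disc of twice the radius turns the one-sided bound into
  quadratic growth of the modulus, and Liouville's theorem for polynomial growth applies.\<close>

lemma entire_Re_le_square_imp_quadratic:
  assumes hol: "g holomorphic_on UNIV" and Re: "\<And>z. Re (g z) \<le> (cmod z)\<^sup>2 / 2 + c"
  obtains C E where "\<And>z. g z = C * z\<^sup>2 + E * z + g 0"
proof -
  define h where "h = (\<lambda>z. g z - g 0)"
  define b where "b = \<bar>c\<bar> + cmod (g 0)"
  have holh: "h holomorphic_on UNIV" unfolding h_def by (intro holomorphic_intros hol)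
  have b: "b \<ge> 0" by (simp add: b_def)
  have hRe: "Re (h z) \<le> (cmod z)\<^sup>2 / 2 + b" for z
    using Re[of z] abs_Re_le_cmod[of "g 0"] by (simp add: h_def b_def)
  have bound: "cmod (h z) \<le> (4 + 2 * b + 2) * cmod z ^ 2" if "1 \<le> cmod z" for z
  proof -
    \<comment> \<open>On the disc of radius \<open>2 * cmod z\<close> the real part is at most
      \<open>2 * (cmod z)\<^sup>2 + b\<close>; the extra \<open>1\<close> makes the inequality
      strict.\<close>
    have "cmod (h z) \<le> 2 * (2 * (cmod z)\<^sup>2 + b + 1)"
    proof (rule Borel_Caratheodory[OF holh, where R = "2 * cmod z"])
      fix w assume "cmod w < 2 * cmod z"
      then have "(cmod w)\<^sup>2 \<le> (2 * cmod z)\<^sup>2" by (intro power_mono) auto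
      then show "Re (h w) < 2 * (cmod z)\<^sup>2 + b + 1"
        using hRe[of w] by (simp add: power_mult_distrib)
    qed (use that b in \<open>auto simp: h_def add_nonneg_pos\<close>)
    also have "\<dots> \<le> (4 + 2 * b + 2) * cmod z ^ 2"
    proof -
      have "1 \<le> (cmod z)\<^sup>2" using that by (simp add: one_le_power)
      then have "b * 1 \<le> b * (cmod z)\<^sup>2" using b by (intro mult_left_mono) auto
      with \<open>1 \<le> (cmod z)\<^sup>2\<close> show ?thesis by (simp add: algebra_simps)
    qed
    finally show ?thesis .
  qed
  have "g z = (deriv ^^ 2) h 0 / 2 * z\<^sup>2 + deriv h 0 * z + g 0" for z
  proof -
    have "{..2} = {0, 1, 2::nat}" by auto
    moreover have "h z = (\<Sum>k\<le>2. (deriv ^^ k) h 0 / fact k * z ^ k)"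
      by (rule Liouville_polynomial[OF holh bound])
    moreover have "h 0 = 0" by (simp add: h_def)
    moreover have "(deriv ^^ 1) h = deriv h" by simp
    ultimately have "h z = deriv h 0 * z + (deriv ^^ 2) h 0 / 2 * z\<^sup>2"
      by (simp del: funpow.simps)
    moreover have "g z = h z + g 0" by (simp add: h_def)
    ultimately show ?thesis by simp
  qed
  then show ?thesis using that by blast
qed

section \<open>The Fock space\<close>

text \<open>The \<open>K w\<close> of the overview. The conjugate falls on \<open>w\<close> because
  \<open>fock_inner\<close> is conjugate linear in its second argument.\<close>

definition fock_kernel :: "complex \<Rightarrow> complex \<Rightarrow> complex" where
  "fock_kernel w z = exp (cnj w * z)"

lemma fock_space_measurable:
  assumes "f \<in> fock_space"
  shows "f \<in> borel_measurable borel"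
  using assms by (intro borel_measurable_continuous_onI holomorphic_on_imp_continuous_on)
    (simp add: fock_space_def)

lemma lborel_integral_shift:
  fixes g :: "'a::euclidean_space \<Rightarrow> 'b::{banach, second_countable_topology}"
  assumes [measurable]: "g \<in> borel_measurable borel"
  shows "(\<integral>z. g (z + w) \<partial>lborel) = (\<integral>z. g z \<partial>lborel)"
  using integral_distr[of "(+) w" lborel borel g] lborel_distr_plus[of w]
  by (simp add: add.commute[of _ w])

lemma lborel_integrable_shift:
  fixes g :: "'a::euclidean_space \<Rightarrow> 'b::{banach, second_countable_topology}"
  assumes [measurable]: "g \<in> borel_measurable borel" and "integrable lborel g"
  shows "integrable lborel (\<lambda>z. g (z + w))"
  using integrable_distr_eq[of "(+) w" lborel borel g] lborel_distr_plus[of w] assms(2)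
  by (simp add: add.commute[of _ w])

lemma fock_integrable_mult:
  assumes f: "f \<in> fock_space" and g: "g \<in> fock_space"
  shows "integrable lborel (\<lambda>z. f z * cnj (g z) * complex_of_real (exp (- (cmod z)\<^sup>2)))"
proof (rule Bochner_Integration.integrable_bound)
  note [measurable] = fock_space_measurable[OF f] fock_space_measurable[OF g]
  show "integrable lborel (\<lambda>z. (cmod (f z))\<^sup>2 * exp (- (cmod z)\<^sup>2) + (cmod (g z))\<^sup>2 * exp (- (cmod z)\<^sup>2))"
    using f g by (auto simp: fock_space_def)
  have [measurable]: "cnj \<in> borel_measurable borel"
    by (intro borel_measurable_continuous_onI continuous_intros)
  show "(\<lambda>z. f z * cnj (g z) * complex_of_real (exp (- (cmod z)\<^sup>2))) \<in> borel_measurable lborel"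
    by measurable
  have "cmod (f z) * cmod (g z) \<le> (cmod (f z))\<^sup>2 + (cmod (g z))\<^sup>2" for z
    using sum_squares_bound[of "cmod (f z)" "cmod (g z)"]
      mult_nonneg_nonneg[OF norm_ge_zero norm_ge_zero, of "f z" "g z"] by linarith
  then have "cmod (f z) * cmod (g z) * exp (- (cmod z)\<^sup>2) \<le>
      ((cmod (f z))\<^sup>2 + (cmod (g z))\<^sup>2) * exp (- (cmod z)\<^sup>2)" for z
    by (rule mult_right_mono) simp
  then show "AE z in lborel. norm (f z * cnj (g z) * complex_of_real (exp (- (cmod z)\<^sup>2)))
      \<le> norm ((cmod (f z))\<^sup>2 * exp (- (cmod z)\<^sup>2) + (cmod (g z))\<^sup>2 * exp (- (cmod z)\<^sup>2))"
    by (simp add: norm_mult distrib_right)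
qed

lemma fock_space_zero [simp]: "(\<lambda>z. 0) \<in> fock_space"
  by (simp add: fock_space_def)

lemma fock_space_cmult:
  assumes "f \<in> fock_space"
  shows "(\<lambda>z. c * f z) \<in> fock_space"
  using assms by (auto simp: fock_space_def norm_mult power_mult_distrib mult.assoc intro!: holomorphic_intros)

lemma fock_space_diff:
  assumes f: "f \<in> fock_space" and g: "g \<in> fock_space"
  shows "(\<lambda>z. f z - g z) \<in> fock_space"
proof -
  note [measurable] = fock_space_measurable[OF f] fock_space_measurable[OF g]
  have "integrable lborel (\<lambda>z. (cmod (f z - g z))\<^sup>2 * exp (- (cmod z)\<^sup>2))"
  proof (rule Bochner_Integration.integrable_bound)
    show "integrable lborel (\<lambda>z. 2 * ((cmod (f z))\<^sup>2 * exp (- (cmod z)\<^sup>2)) + 2 * ((cmod (g z))\<^sup>2 * exp (- (cmod z)\<^sup>2)))"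
      using f g by (auto simp: fock_space_def)
    have "(cmod (f z - g z))\<^sup>2 \<le> 2 * (cmod (f z))\<^sup>2 + 2 * (cmod (g z))\<^sup>2" for z
    proof -
      have "(cmod (f z - g z))\<^sup>2 \<le> (cmod (f z) + cmod (g z))\<^sup>2"
        by (intro power_mono norm_triangle_ineq4) simp
      also have "\<dots> \<le> 2 * (cmod (f z))\<^sup>2 + 2 * (cmod (g z))\<^sup>2"
        using sum_squares_bound[of "cmod (f z)" "cmod (g z)"] by (simp add: power2_sum)
      finally show ?thesis .
    qed
    then have "(cmod (f z - g z))\<^sup>2 * exp (- (cmod z)\<^sup>2) \<le>
       (2 * (cmod (f z))\<^sup>2 + 2 * (cmod (g z))\<^sup>2) * exp (- (cmod z)\<^sup>2)" for z
      by (rule mult_right_mono) simp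
    then show "AE z in lborel. norm ((cmod (f z - g z))\<^sup>2 * exp (- (cmod z)\<^sup>2)) \<le>
       norm (2 * ((cmod (f z))\<^sup>2 * exp (- (cmod z)\<^sup>2)) + 2 * ((cmod (g z))\<^sup>2 * exp (- (cmod z)\<^sup>2)))"
      by (simp add: algebra_simps)
  qed measurable
  with f g show ?thesis by (auto simp: fock_space_def intro!: holomorphic_intros)
qed

lemma fock_inner_zero_right [simp]: "fock_inner f (\<lambda>z. 0) = 0"
  by (simp add: fock_inner_def)

lemma fock_inner_cmult_right: "fock_inner f (\<lambda>z. c * g z) = cnj c * fock_inner f g"
proof -
  have "(\<integral>z. f z * cnj (c * g z) * complex_of_real (exp (- (cmod z)\<^sup>2)) \<partial>lborel) =
     (\<integral>z. cnj c * (f z * cnj (g z) * complex_of_real (exp (- (cmod z)\<^sup>2))) \<partial>lborel)"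
    by (simp add: mult_ac)
  also have "\<dots> = cnj c * (\<integral>z. f z * cnj (g z) * complex_of_real (exp (- (cmod z)\<^sup>2)) \<partial>lborel)"
    by (rule integral_mult_right_zero)
  finally show ?thesis by (simp add: fock_inner_def)
qed

lemma fock_inner_diff_right:
  assumes "f \<in> fock_space" "g \<in> fock_space" "h \<in> fock_space"
  shows "fock_inner f (\<lambda>z. g z - h z) = fock_inner f g - fock_inner f h"
  using Bochner_Integration.integral_diff[OF fock_integrable_mult[OF assms(1,2)] fock_integrable_mult[OF assms(1,3)]]
  by (simp add: fock_inner_def left_diff_distrib right_diff_distrib diff_divide_distrib)

text \<open>This holds for every \<open>f\<close>, since an integrand that is not integrable has
  integral \<open>0\<close> on both sides. So \<open>fock_norm\<close> is nonnegative and
  homogeneous on all functions.\<close>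

lemma fock_norm_eq:
  "fock_norm f = sqrt ((\<integral>z. (cmod (f z))\<^sup>2 * exp (- (cmod z)\<^sup>2) \<partial>lborel) / pi)"
proof -
  have "f z * cnj (f z) * complex_of_real (exp (- (cmod z)\<^sup>2)) =
        complex_of_real ((cmod (f z))\<^sup>2 * exp (- (cmod z)\<^sup>2))" for z
    by (simp only: complex_norm_square of_real_mult)
  then have "fock_inner f f = complex_of_real ((\<integral>z. (cmod (f z))\<^sup>2 * exp (- (cmod z)\<^sup>2) \<partial>lborel) / pi)"
    unfolding fock_inner_def by (simp only: integral_complex_of_real) simp
  then show ?thesis by (simp add: fock_norm_def)
qed

lemma fock_norm_nonneg: "fock_norm f \<ge> 0"
  by (simp add: fock_norm_eq)

lemma fock_norm_zero [simp]: "fock_norm (\<lambda>z. 0) = 0"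
  by (simp add: fock_norm_eq)

lemma fock_norm_cmult: "fock_norm (\<lambda>z. c * f z) = cmod c * fock_norm f"
  by (simp add: fock_norm_eq norm_mult power_mult_distrib mult.assoc real_sqrt_mult real_sqrt_divide)

text \<open>Law of cosines. For orthogonal \<open>f\<close> and \<open>g\<close> it bounds the norm
  of \<open>f\<close> by that of the difference, which yields uniqueness of the adjoint.\<close>

lemma fock_norm_diff_sq:
  assumes f: "f \<in> fock_space" and g: "g \<in> fock_space"
  shows "(fock_norm (\<lambda>z. f z - g z))\<^sup>2 = (fock_norm f)\<^sup>2 + (fock_norm g)\<^sup>2 - 2 * Re (fock_inner g f)"
proof -
  let ?e = "\<lambda>z. exp (- (cmod z)\<^sup>2)"
  have int: "integrable lborel (\<lambda>z. (cmod (f z))\<^sup>2 * ?e z)" "integrable lborel (\<lambda>z. (cmod (g z))\<^sup>2 * ?e z)"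
    using f g by (auto simp: fock_space_def)
  have intc: "integrable lborel (\<lambda>z. g z * cnj (f z) * complex_of_real (?e z))"
    by (rule fock_integrable_mult[OF g f])
  have sq: "(fock_norm h)\<^sup>2 = (\<integral>z. (cmod (h z))\<^sup>2 * ?e z \<partial>lborel) / pi" for h
    by (simp add: fock_norm_eq)
  have expand: "(cmod (a - b))\<^sup>2 = (cmod a)\<^sup>2 + (cmod b)\<^sup>2 - 2 * Re (b * cnj a)" for a b
    unfolding cmod_power2 by (simp add: power2_eq_square algebra_simps)
  have "(cmod (f z - g z))\<^sup>2 * ?e z = (cmod (f z))\<^sup>2 * ?e z + (cmod (g z))\<^sup>2 * ?e z
      - 2 * Re (g z * cnj (f z) * complex_of_real (?e z))" for z
    unfolding expand by (simp add: algebra_simps)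
  then have "(\<integral>z. (cmod (f z - g z))\<^sup>2 * ?e z \<partial>lborel) =
     (\<integral>z. (cmod (f z))\<^sup>2 * ?e z \<partial>lborel) + (\<integral>z. (cmod (g z))\<^sup>2 * ?e z \<partial>lborel)
      - 2 * (\<integral>z. Re (g z * cnj (f z) * complex_of_real (?e z)) \<partial>lborel)"
    using int integrable_Re[OF intc] by simp
  also have "(\<integral>z. Re (g z * cnj (f z) * complex_of_real (?e z)) \<partial>lborel) = pi * Re (fock_inner g f)"
    unfolding integral_Re[OF intc] by (simp add: fock_inner_def)
  finally show ?thesis by (simp add: sq field_simps)
qed

lemma cmod_add_sq: "(cmod (z + w))\<^sup>2 = (cmod z)\<^sup>2 + 2 * Re (cnj w * z) + (cmod w)\<^sup>2"
  unfolding cmod_power2 by (simp add: power2_eq_square algebra_simps)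

text \<open>Completing the square turns the weighted square of the kernel into a multiple of the
  Gaussian centred at \<open>w\<close>.\<close>

lemma fock_kernel_in_fock_space: "fock_kernel w \<in> fock_space"
proof -
  have "integrable lborel (\<lambda>z. exp (- (cmod (z + (- w)))\<^sup>2))"
    using gaussian_complex
    by (intro lborel_integrable_shift[where g = "\<lambda>z. exp (- (cmod z)\<^sup>2)"]) (auto simp: has_bochner_integral_iff)
  then have "integrable lborel (\<lambda>z. exp ((cmod w)\<^sup>2) * exp (- (cmod (z + (- w)))\<^sup>2))"
    by simp
  moreover have "(cmod (fock_kernel w z))\<^sup>2 * exp (- (cmod z)\<^sup>2) =
      exp ((cmod w)\<^sup>2) * exp (- (cmod (z + (- w)))\<^sup>2)" for z
    unfolding cmod_add_sq
    by (simp add: fock_kernel_def norm_exp_eq_Re exp_double[symmetric] exp_add[symmetric])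
  ultimately have "integrable lborel (\<lambda>z. (cmod (fock_kernel w z))\<^sup>2 * exp (- (cmod z)\<^sup>2))"
    by simp
  then show ?thesis
    by (auto simp: fock_space_def fock_kernel_def[abs_def] intro!: holomorphic_intros)
qed

text \<open>After the substitution \<open>z \<mapsto> z + w\<close> the integrand becomes \<open>f (z + w) exp (- cnj w z)\<close> times
  the Gaussian weight, so the mean value property at \<open>0\<close> applies.\<close>

lemma fock_reproducing:
  assumes f: "f \<in> fock_space"
  shows "fock_inner f (fock_kernel w) = f w"
proof -
  define G where "G = (\<lambda>z. f z * cnj (fock_kernel w z) * complex_of_real (exp (- (cmod z)\<^sup>2)))"
  define F where "F = (\<lambda>z. f (z + w) * exp (- (cnj w * z)))"
  have holf: "f holomorphic_on UNIV" using f by (simp add: fock_space_def)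
  have "(\<lambda>z. f (z + w)) holomorphic_on UNIV"
    by (rule holomorphic_on_compose_gen[of _ _ f UNIV, unfolded comp_def])
      (auto intro!: holomorphic_intros holf)
  then have holF: "F holomorphic_on UNIV"
    unfolding F_def by (intro holomorphic_intros)
  have G: "integrable lborel G"
    unfolding G_def by (rule fock_integrable_mult[OF f fock_kernel_in_fock_space])
  then have Gm: "G \<in> borel_measurable borel" by auto
  have GF: "G (z + w) = F z * complex_of_real (exp (- (cmod z)\<^sup>2))" for z
  proof -
    \<comment> \<open>The antiholomorphic term \<open>w * cnj z\<close> cancels, so the factor
      beside the Gaussian is holomorphic in \<open>z\<close>.\<close>
    have "exp (w * (cnj z + cnj w)) * complex_of_real (exp (- (cmod (z + w))\<^sup>2)) =
          exp (w * (cnj z + cnj w) - complex_of_real ((cmod (z + w))\<^sup>2))"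
      by (simp add: exp_of_real[symmetric] exp_add[symmetric])
    also have "w * (cnj z + cnj w) - complex_of_real ((cmod (z + w))\<^sup>2) =
       - (cnj w * z) - complex_of_real ((cmod z)\<^sup>2)"
      by (simp only: complex_norm_square) (simp add: algebra_simps)
    also have "exp \<dots> = exp (- (cnj w * z)) * complex_of_real (exp (- (cmod z)\<^sup>2))"
      by (simp add: exp_of_real[symmetric] exp_add[symmetric])
    finally show ?thesis
      by (simp add: G_def F_def fock_kernel_def exp_cnj mult.assoc)
  qed
  have "(\<integral>z. G z \<partial>lborel) = (\<integral>z. F z * complex_of_real (exp (- (cmod z)\<^sup>2)) \<partial>lborel)"
    using lborel_integral_shift[OF Gm, of w] by (simp add: GF)
  also have "\<dots> = F 0 * complex_of_real (\<integral>z. exp (- (cmod z)\<^sup>2) \<partial>lborel)"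
    using lborel_integrable_shift[OF Gm G, of w] gaussian_complex
    by (intro integral_radial_mult_holomorphic[OF holF])
       (auto simp: GF norm_mult has_bochner_integral_iff)
  also have "\<dots> = f w * pi"
    using gaussian_complex by (simp add: F_def has_bochner_integral_iff)
  finally show ?thesis by (simp add: fock_inner_def G_def)
qed

lemma fock_norm_kernel: "fock_norm (fock_kernel w) = exp ((cmod w)\<^sup>2 / 2)"
proof -
  have "cnj w * w = complex_of_real ((cmod w)\<^sup>2)"
    by (simp only: complex_norm_square mult.commute)
  then have "fock_inner (fock_kernel w) (fock_kernel w) = exp (complex_of_real ((cmod w)\<^sup>2))"
    unfolding fock_reproducing[OF fock_kernel_in_fock_space] by (simp add: fock_kernel_def)
  then have "fock_norm (fock_kernel w) = sqrt (exp ((cmod w)\<^sup>2))"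
    by (simp add: fock_norm_def Re_exp)
  also have "exp ((cmod w)\<^sup>2) = (exp ((cmod w)\<^sup>2 / 2))\<^sup>2"
    by (simp add: exp_double[symmetric])
  finally show ?thesis by simp
qed

section \<open>Pointwise bounds and decay at infinity\<close>

lemma integrable_indicator_gaussian:
  fixes A :: "complex set"
  assumes [measurable]: "A \<in> sets borel"
  shows "integrable lborel (\<lambda>z. indicator A z * exp (- (cmod z)\<^sup>2) :: real)"
proof (rule Bochner_Integration.integrable_bound)
  show "integrable lborel (\<lambda>z::complex. exp (- (cmod z)\<^sup>2))"
    using gaussian_complex by (simp add: has_bochner_integral_iff)
qed (auto simp: indicator_def)

text \<open>Applying the mean value property to the square of the translate of \<open>f\<close> gives the
  estimate without a Cauchy--Schwarz inequality.\<close>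

lemma fock_mean_value_estimate:
  assumes f: "f \<in> fock_space" and [measurable]: "A \<in> sets borel"
    and rad: "\<And>c z. cmod c = 1 \<Longrightarrow> c * z \<in> A \<longleftrightarrow> z \<in> A"
  shows "(cmod (f w))\<^sup>2 * exp (- (cmod w)\<^sup>2) * (\<integral>z. indicator A z * exp (- (cmod z)\<^sup>2) \<partial>lborel) \<le>
    (\<integral>z. indicator A (z - w) * ((cmod (f z))\<^sup>2 * exp (- (cmod z)\<^sup>2)) \<partial>lborel)"
proof -
  define \<rho> where "\<rho> = (\<lambda>z. indicator A z * exp (- (cmod z)\<^sup>2))"
  \<comment> \<open>The base of the square is the Weyl translate of \<open>f\<close>, an isometry of
    the Fock space that moves \<open>w\<close> to the origin.\<close>
  define F where "F = (\<lambda>z. (f (z + w) * exp (- (cnj w * z) - complex_of_real ((cmod w)\<^sup>2 / 2)))\<^sup>2)"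
  note [measurable] = fock_space_measurable[OF f]
  have holf: "f holomorphic_on UNIV" using f by (simp add: fock_space_def)
  have "(\<lambda>z. f (z + w)) holomorphic_on UNIV"
    by (rule holomorphic_on_compose_gen[of _ _ f UNIV, unfolded comp_def])
      (auto intro!: holomorphic_intros holf)
  then have holF: "F holomorphic_on UNIV"
    unfolding F_def by (intro holomorphic_intros)
  define g where "g = (\<lambda>z. indicator A (z - w) * ((cmod (f z))\<^sup>2 * exp (- (cmod z)\<^sup>2)))"
  have [measurable]: "g \<in> borel_measurable borel" "\<rho> \<in> borel_measurable borel"
    unfolding g_def \<rho>_def by measurable
  have [measurable]: "F \<in> borel_measurable borel"
    using holF by (intro borel_measurable_continuous_onI holomorphic_on_imp_continuous_on)
  have g: "integrable lborel g"
  proof (rule Bochner_Integration.integrable_bound)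
    show "integrable lborel (\<lambda>z. (cmod (f z))\<^sup>2 * exp (- (cmod z)\<^sup>2))"
      using f by (simp add: fock_space_def)
  qed (auto simp: g_def indicator_def)
  have Fg: "cmod (F z * complex_of_real (\<rho> z)) = g (z + w)" for z
  proof -
    have "(cmod (exp (- (cnj w * z) - complex_of_real ((cmod w)\<^sup>2 / 2))))\<^sup>2 * exp (- (cmod z)\<^sup>2) =
          exp (- (cmod (z + w))\<^sup>2)"
      unfolding cmod_add_sq
      by (simp add: norm_exp_eq_Re exp_double[symmetric] exp_add[symmetric] algebra_simps)
    then show ?thesis
      by (simp add: F_def \<rho>_def g_def norm_mult norm_power power_mult_distrib)
  qed
  have int\<rho>: "integrable lborel \<rho>"
    unfolding \<rho>_def by (rule integrable_indicator_gaussian) measurable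
  have intF: "integrable lborel (\<lambda>z. F z * complex_of_real (\<rho> z))"
  proof (rule Bochner_Integration.integrable_bound)
    show "integrable lborel (\<lambda>z. g (z + w))" by (rule lborel_integrable_shift[OF _ g]) measurable
    show "AE z in lborel. norm (F z * complex_of_real (\<rho> z)) \<le> norm (g (z + w))"
      unfolding Fg by simp
  qed measurable
  have "(\<integral>z. F z * complex_of_real (\<rho> z) \<partial>lborel) = F 0 * complex_of_real (\<integral>z. \<rho> z \<partial>lborel)"
    by (rule integral_radial_mult_holomorphic[OF holF _ _ int\<rho> intF])
       (auto simp: \<rho>_def norm_mult indicator_def rad)
  then have "cmod (F 0) * \<bar>\<integral>z. \<rho> z \<partial>lborel\<bar> = cmod (\<integral>z. F z * complex_of_real (\<rho> z) \<partial>lborel)"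
    by (simp add: norm_mult)
  also have "\<dots> \<le> (\<integral>z. cmod (F z * complex_of_real (\<rho> z)) \<partial>lborel)"
    by (rule integral_norm_bound)
  also have "\<dots> = (\<integral>z. g z \<partial>lborel)"
    unfolding Fg by (rule lborel_integral_shift) measurable
  finally have "cmod (F 0) * \<bar>\<integral>z. \<rho> z \<partial>lborel\<bar> \<le> (\<integral>z. g z \<partial>lborel)" .
  moreover have "cmod (F 0) = (cmod (f w))\<^sup>2 * exp (- (cmod w)\<^sup>2)"
    by (simp add: F_def norm_mult norm_power power_mult_distrib norm_exp_eq_Re exp_double[symmetric])
  moreover have "(\<integral>z. \<rho> z \<partial>lborel) \<ge> 0"
    by (rule integral_nonneg_AE) (simp add: \<rho>_def)
  ultimately show ?thesis by (simp add: \<rho>_def g_def)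
qed

text \<open>The mean value estimate with \<open>A = UNIV\<close>, where the Gaussian integral is
  \<open>pi\<close>.\<close>

lemma fock_pointwise_bound:
  assumes f: "f \<in> fock_space"
  shows "cmod (f w) \<le> fock_norm f * exp ((cmod w)\<^sup>2 / 2)"
proof -
  have "(cmod (f w))\<^sup>2 * exp (- (cmod w)\<^sup>2) * pi \<le> (\<integral>z. (cmod (f z))\<^sup>2 * exp (- (cmod z)\<^sup>2) \<partial>lborel)"
    using fock_mean_value_estimate[OF f, of UNIV w] gaussian_complex
    by (simp add: has_bochner_integral_iff)
  also have "\<dots> = (fock_norm f)\<^sup>2 * pi"
    by (simp add: fock_norm_eq)
  finally have "(cmod (f w))\<^sup>2 \<le> (fock_norm f)\<^sup>2 * exp ((cmod w)\<^sup>2)"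
    by (simp add: exp_minus field_simps)
  also have "\<dots> = (fock_norm f * exp ((cmod w)\<^sup>2 / 2))\<^sup>2"
    by (simp add: power_mult_distrib exp_double[symmetric])
  finally show ?thesis
    by (rule power2_le_imp_le) (simp add: fock_norm_nonneg)
qed

lemma fock_norm_le_0_imp_zero:
  assumes "f \<in> fock_space" "fock_norm f \<le> 0"
  shows "f = (\<lambda>z. 0)"
  using fock_pointwise_bound[OF assms(1)] assms(2) fock_norm_nonneg[of f] by fastforce

text \<open>With the unit disc as \<open>A\<close>, the value at \<open>w n\<close> is controlled by
  the mass of \<open>f\<close> in the unit disc around \<open>w n\<close>. These discs eventually
  leave every point, so dominated convergence applies.\<close>

lemma fock_decay:
  assumes f: "f \<in> fock_space" and w: "filterlim (\<lambda>n. cmod (w n)) at_top sequentially"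
  shows "(\<lambda>n. (cmod (f (w n)))\<^sup>2 * exp (- (cmod (w n))\<^sup>2)) \<longlonglongrightarrow> 0"
proof -
  note [measurable] = fock_space_measurable[OF f]
  let ?h = "\<lambda>z. (cmod (f z))\<^sup>2 * exp (- (cmod z)\<^sup>2)"
  let ?B = "ball 0 1 :: complex set"
  define m where "m = (\<integral>z. indicator ?B z * exp (- (cmod z)\<^sup>2) \<partial>lborel)"
  have "m > 0"
  proof -
    have "exp (-1) * measure lborel ?B = (\<integral>z. indicator ?B z * exp (-1) \<partial>lborel)"
      by simp
    also have "\<dots> \<le> m" unfolding m_def
    proof (rule integral_mono)
      show "integrable lborel (\<lambda>z. indicator ?B z * exp (-1) :: real)"
        using emeasure_bounded_finite[of ?B]
        by (intro integrable_mult_left integrable_real_indicator) auto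
      show "integrable lborel (\<lambda>z. indicator ?B z * exp (- (cmod z)\<^sup>2))"
        by (rule integrable_indicator_gaussian) simp
    qed (auto simp: indicator_def power_le_one)
    finally show ?thesis
      using content_ball_pos[of 1 "0::complex"] by (smt (verit) exp_gt_zero mult_pos_pos)
  qed
  have lim: "(\<lambda>n. \<integral>z. indicator ?B (z - w n) * ?h z \<partial>lborel) \<longlonglongrightarrow> (\<integral>z. 0 \<partial>(lborel :: complex measure))"
  proof (rule integral_dominated_convergence[where w = ?h])
    show "integrable lborel ?h" using f by (simp add: fock_space_def)
    show "AE z in lborel. (\<lambda>n. indicator ?B (z - w n) * ?h z) \<longlonglongrightarrow> 0"
    proof (rule AE_I2, rule tendsto_eventually)
      fix z
      have "eventually (\<lambda>n. cmod (w n) \<ge> cmod z + 1) sequentially"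
        using w by (simp add: filterlim_at_top)
      then show "eventually (\<lambda>n. indicator ?B (z - w n) * ?h z = 0) sequentially"
      proof eventually_elim
        case (elim n)
        have "cmod (w n) \<le> cmod z + cmod (z - w n)"
          by (metis norm_triangle_sub norm_minus_commute)
        with elim show ?case by (simp add: indicator_def)
      qed
    qed
  qed (auto simp: indicator_def)
  have le: "?h (w n) \<le> (\<integral>z. indicator ?B (z - w n) * ?h z \<partial>lborel) / m" for n
    using fock_mean_value_estimate[OF f, of ?B "w n"] \<open>m > 0\<close>
    by (simp add: norm_mult m_def pos_le_divide_eq)
  have lim': "(\<lambda>n. (\<integral>z. indicator ?B (z - w n) * ?h z \<partial>lborel) / m) \<longlonglongrightarrow> 0"
    using tendsto_divide[OF lim tendsto_const[of m]] \<open>m > 0\<close> by simp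
  show ?thesis
    by (rule tendsto_sandwich[OF _ _ tendsto_const lim']) (use le in auto)
qed

section \<open>Weighted composition operators\<close>

text \<open>Two candidates differ by some \<open>d\<close> orthogonal to \<open>D\<close>. Elements
  of \<open>D\<close> come arbitrarily close to \<open>d\<close>, yet by orthogonality none is
  closer than the norm of \<open>d\<close>.\<close>

lemma adj_op_eqI:
  assumes D: "fock_dense D" "D \<subseteq> fock_space"
    and h: "h \<in> fock_space" "\<And>f. f \<in> D \<Longrightarrow> fock_inner (T f) g = fock_inner f h"
  shows "adj_op D T g = h"
  unfolding adj_op_def
proof (rule the_equality)
  fix k assume k: "k \<in> fock_space \<and> (\<forall>f\<in>D. fock_inner (T f) g = fock_inner f k)"
  define d where "d = (\<lambda>z. k z - h z)"
  have d: "d \<in> fock_space" unfolding d_def using k h by (intro fock_space_diff) auto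
  have orth: "fock_inner f d = 0" if "f \<in> D" for f
    unfolding d_def using that k h D(2) by (subst fock_inner_diff_right) auto
  have "fock_norm d < e" if "e > 0" for e
  proof -
    obtain f where f: "f \<in> D" "fock_norm (\<lambda>z. d z - f z) < e"
      using D(1) d \<open>e > 0\<close> unfolding fock_dense_def by blast
    have "(fock_norm d)\<^sup>2 \<le> (fock_norm (\<lambda>z. d z - f z))\<^sup>2"
      using fock_norm_diff_sq[OF d, of f] f(1) D(2) orth[OF f(1)] by auto
    then have "fock_norm d \<le> fock_norm (\<lambda>z. d z - f z)"
      by (rule power2_le_imp_le) (rule fock_norm_nonneg)
    with f(2) show ?thesis by simp
  qed
  then have "fock_norm d \<le> 0"
    by (meson less_irrefl not_le)
  then have "d = (\<lambda>z. 0)" by (rule fock_norm_le_0_imp_zero[OF d])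
  then show "k = h" unfolding d_def by (metis eq_iff_diff_eq_0 ext)
qed (use h in auto)

text \<open>\<open>f\<close> vanishes on the image under \<open>\<phi>\<close> of the set where
  \<open>\<psi>\<close> is nonzero. That image is open by the open mapping theorem, and the identity
  theorem finishes.\<close>

lemma wcomp_eq_zero_imp_zero:
  assumes hol: "\<psi> holomorphic_on UNIV" "\<phi> holomorphic_on UNIV" "f holomorphic_on UNIV"
    and nz: "\<psi> z0 \<noteq> 0" "\<not> \<phi> constant_on UNIV"
    and eq: "wcomp \<psi> \<phi> f = (\<lambda>z. 0)"
  shows "f = (\<lambda>z. 0)"
proof
  fix z
  define U where "U = {z. \<psi> z \<noteq> 0}"
  have "open U"
    unfolding U_def using holomorphic_on_imp_continuous_on[OF hol(1)]
    by (intro open_Collect_neq continuous_on_const) auto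
  then have "open (\<phi> ` U)"
    by (intro open_mapping_thm[OF hol(2) open_UNIV connected_UNIV _ _ nz(2)]) auto
  moreover have "\<phi> ` U \<noteq> {}" using nz(1) by (auto simp: U_def)
  moreover have "f x = 0" if "x \<in> \<phi> ` U" for x
    using that fun_cong[OF eq] by (auto simp: U_def wcomp_def)
  ultimately show "f z = 0"
    using analytic_continuation_open[of "\<phi> ` U" UNIV f "\<lambda>z. 0" z] hol(3) by auto
qed

lemma fock_nonvanishing_imp_gaussian:
  assumes f: "f \<in> fock_space" and nz: "\<And>z. f z \<noteq> 0"
  obtains C E where "cmod C < 1 / 2" "\<And>z. f z = f 0 * exp (C * z\<^sup>2 + E * z)"
proof -
  have hol: "f holomorphic_on UNIV" using f by (simp add: fock_space_def)
  obtain g where g: "g holomorphic_on UNIV" "\<And>z. f z = exp (g z)"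
    using contractible_imp_holomorphic_log[OF hol _ nz] by (auto intro: convex_imp_contractible)
  \<comment> \<open>Adding \<open>1\<close> keeps the argument of the logarithm positive.\<close>
  define c where "c = ln (fock_norm f + 1)"
  have c: "exp c = fock_norm f + 1"
    using fock_norm_nonneg[of f] by (simp add: c_def)
  have "Re (g z) \<le> (cmod z)\<^sup>2 / 2 + c" for z
  proof -
    have "exp (Re (g z)) = cmod (f z)" by (simp add: g(2))
    also have "\<dots> \<le> fock_norm f * exp ((cmod z)\<^sup>2 / 2)" by (rule fock_pointwise_bound[OF f])
    also have "\<dots> \<le> exp c * exp ((cmod z)\<^sup>2 / 2)" unfolding c by (simp add: mult_right_mono)
    also have "\<dots> = exp ((cmod z)\<^sup>2 / 2 + c)" by (simp add: exp_add)
    finally show ?thesis by simp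
  qed
  then obtain C E where CE: "\<And>z. g z = C * z\<^sup>2 + E * z + g 0"
    using entire_Re_le_square_imp_quadratic[OF g(1)] by blast
  have form: "f z = f 0 * exp (C * z\<^sup>2 + E * z)" for z
    using CE[of z] by (simp add: g(2) exp_add mult_ac)
  have "cmod C < 1 / 2"
  proof (rule ccontr)
    assume "\<not> cmod C < 1 / 2"
    then have C: "cmod C \<ge> 1 / 2" by simp
    then have C0: "C \<noteq> 0" by auto
    \<comment> \<open>A unit direction in which the quadratic term is real and positive, so that it
      grows fastest.\<close>
    define u where "u = csqrt (cnj C / of_real (cmod C))"
    have u2: "u\<^sup>2 = cnj C / of_real (cmod C)" by (simp add: u_def)
    then have Cu: "C * u\<^sup>2 = of_real (cmod C)"
      using C0 complex_norm_square[of C] by (simp add: power2_eq_square divide_eq_eq)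
    have "(cmod u)\<^sup>2 = 1"
      using C0 by (simp flip: norm_power add: u2 norm_divide)
    then have u1: "cmod u = 1"
      by (simp add: power2_eq_1_iff) (use norm_ge_zero[of u] in linarith)
    \<comment> \<open>The sign selects the half-line on which the linear term has nonnegative real
      part. If \<open>cmod C\<close> is at least 1/2, the weighted modulus there never drops below
      its value at \<open>0\<close>, against \<open>fock_decay\<close>.\<close>
    define s :: real where "s = (if Re (E * u) \<ge> 0 then 1 else -1)"
    have s: "s\<^sup>2 = 1" "\<bar>s\<bar> = 1" "s * Re (E * u) \<ge> 0" by (auto simp: s_def)
    define w where "w = (\<lambda>n. of_real (s * real n) * u)"
    have w: "cmod (w n) = real n" for n
      by (simp add: w_def norm_mult u1 s abs_mult)
    have "(\<lambda>n. (cmod (f (w n)))\<^sup>2 * exp (- (cmod (w n))\<^sup>2)) \<longlonglongrightarrow> 0"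
      by (rule fock_decay[OF f]) (simp add: w filterlim_real_sequentially)
    moreover have "(cmod (f 0))\<^sup>2 \<le> (cmod (f (w n)))\<^sup>2 * exp (- (cmod (w n))\<^sup>2)" for n
    proof -
      have "C * (w n)\<^sup>2 = of_real ((s * real n)\<^sup>2) * (C * u\<^sup>2)"
        by (simp add: w_def power_mult_distrib mult_ac)
      then have "Re (C * (w n)\<^sup>2) = (real n)\<^sup>2 * cmod C"
        unfolding Cu using s by (simp add: power_mult_distrib flip: of_real_power of_real_mult)
      moreover have "Re (E * w n) = real n * (s * Re (E * u))"
        by (simp add: w_def algebra_simps)
      then have "Re (E * w n) \<ge> 0" using s by simp
      moreover have "(real n)\<^sup>2 * cmod C \<ge> (real n)\<^sup>2 * (1 / 2)"
        using C by (intro mult_left_mono) auto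
      ultimately have ge: "2 * Re (C * (w n)\<^sup>2 + E * w n) - (real n)\<^sup>2 \<ge> 0"
        by simp
      have "(cmod (f (w n)))\<^sup>2 * exp (- (cmod (w n))\<^sup>2) =
          (cmod (f 0))\<^sup>2 * exp (2 * Re (C * (w n)\<^sup>2 + E * w n) - (real n)\<^sup>2)"
        unfolding form[of "w n"] w norm_mult norm_exp_eq_Re
        by (simp add: power_mult_distrib exp_double[symmetric] exp_add[symmetric] mult.assoc)
      also have "\<dots> \<ge> (cmod (f 0))\<^sup>2 * 1"
        using ge by (intro mult_left_mono) auto
      finally show ?thesis by simp
    qed
    ultimately have "(cmod (f 0))\<^sup>2 \<le> 0"
      by (intro LIMSEQ_le_const) auto
    with nz[of 0] show False by simp
  qed
  with form show ?thesis using that by blast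
qed

theorem theorem3p3:
  fixes \<psi> \<phi> :: "complex \<Rightarrow> complex"
    and D :: "(complex \<Rightarrow> complex) set"
    and S :: "(complex \<Rightarrow> complex) \<Rightarrow> complex \<Rightarrow> complex"
  assumes "\<psi> holomorphic_on UNIV" and "\<exists>z. \<psi> z \<noteq> 0"
    and "\<phi> holomorphic_on UNIV" and "\<not> \<phi> constant_on UNIV"
    and "is_wcomp_dom \<psi> \<phi> D" and "fock_dense D"
    and "\<forall>f\<in>fock_space. S f \<in> fock_space"
    and "\<forall>f\<in>fock_space. S (S f) = f"
    and "adj_dom D (wcomp \<psi> \<phi>) \<subseteq> comp_dom D S"
    and "\<forall>f\<in>adj_dom D (wcomp \<psi> \<phi>).
           fock_norm (wcomp \<psi> \<phi> (S f)) \<le> fock_norm (adj_op D (wcomp \<psi> \<phi>) f)"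
  shows "(\<forall>z. \<psi> z \<noteq> 0) \<and>
    (\<psi> \<in> fock_space \<longrightarrow>
      (\<exists>C E. cmod C < 1 / 2 \<and> \<psi> 0 \<noteq> 0 \<and> (\<forall>z. \<psi> z = \<psi> 0 * exp (C * z\<^sup>2 + E * z)))) \<and>
    (\<exists>A B. A \<noteq> 0 \<and> (\<forall>z. \<phi> z = A * z + B) \<and>
      (A = 1 \<and> (\<forall>f\<in>fock_space. S f = f) \<longrightarrow>
        (\<exists>E. \<psi> 0 \<noteq> 0 \<and> (\<forall>z. \<psi> z = \<psi> 0 * exp (E * z)) \<and> cmod E \<le> cmod B)))"
proof -
  define W where "W = wcomp \<psi> \<phi>"
  have Dfock: "D \<subseteq> fock_space" and WD: "\<And>f. f \<in> D \<Longrightarrow> W f \<in> fock_space"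
    using assms(5) by (auto simp: is_wcomp_dom_def fock_subspace_def wcomp_max_dom_def W_def)
  \<comment> \<open>Any \<open>h\<close> representing \<open>f \<mapsto> fock_inner (W f) g\<close>
    on \<open>D\<close> is \<open>W\<^sup>* g\<close>. From here on both hypotheses on
    \<open>S\<close> are used only through such an explicit \<open>h\<close>.\<close>
  have key: "S g \<in> D" "fock_norm (W (S g)) \<le> fock_norm h"
    if "g \<in> fock_space" "h \<in> fock_space" "\<And>f. f \<in> D \<Longrightarrow> fock_inner (W f) g = fock_inner f h" for g h
  proof -
    have "g \<in> adj_dom D W" using that by (auto simp: adj_dom_def)
    moreover have "adj_op D W g = h"
      using that by (intro adj_op_eqI assms(6) Dfock)
    ultimately show "S g \<in> D" "fock_norm (W (S g)) \<le> fock_norm h"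
      using assms(9,10) by (auto simp: comp_dom_def W_def)
  qed
  have S_ker: "S g = (\<lambda>z. 0)"
    if g: "g \<in> fock_space" "\<And>f. f \<in> D \<Longrightarrow> fock_inner (W f) g = 0" for g
  proof -
    have SD: "S g \<in> D" and le: "fock_norm (W (S g)) \<le> fock_norm (\<lambda>z. 0)"
      using key[of g "\<lambda>z. 0"] g by auto
    have "W (S g) = (\<lambda>z. 0)"
      using le by (intro fock_norm_le_0_imp_zero WD SD) simp
    moreover obtain z0 where "\<psi> z0 \<noteq> 0" using assms(2) by blast
    moreover have "S g holomorphic_on UNIV" using SD Dfock by (auto simp: fock_space_def)
    ultimately show ?thesis
      using assms(1,3,4) wcomp_eq_zero_imp_zero[of \<psi> \<phi> "S g"] by (auto simp: W_def)
  qed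
  have ker: "g = (\<lambda>z. 0)"
    if g: "g \<in> fock_space" "\<And>f. f \<in> D \<Longrightarrow> fock_inner (W f) g = 0" for g
  proof -
    have "g = S (S g)" using assms(8) g(1) by simp
    \<comment> \<open>\<open>S\<close> need not be linear; that it fixes zero comes from
      \<open>S_ker\<close> applied to the zero function.\<close>
    also have "\<dots> = (\<lambda>z. 0)" using S_ker[OF g] S_ker[of "\<lambda>z. 0"] by simp
    finally show ?thesis .
  qed
  have WK: "fock_inner (W f) (fock_kernel w) = \<psi> w * f (\<phi> w)" if "f \<in> D" for f w
    using fock_reproducing[OF WD[OF that]] by (simp add: W_def wcomp_def)
  have psi_nz: "\<psi> w \<noteq> 0" for w
  proof
    assume "\<psi> w = 0"
    then have "fock_kernel w = (\<lambda>z. 0)"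
      by (intro ker[OF fock_kernel_in_fock_space]) (simp add: WK)
    then have "fock_kernel w 0 = 0" by simp
    then show False by (simp add: fock_kernel_def)
  qed
  have psi_form: "\<exists>C E. cmod C < 1 / 2 \<and> \<psi> 0 \<noteq> 0 \<and> (\<forall>z. \<psi> z = \<psi> 0 * exp (C * z\<^sup>2 + E * z))"
    if "\<psi> \<in> fock_space"
    using fock_nonvanishing_imp_gaussian[OF that psi_nz] psi_nz by metis
  have "inj \<phi>"
  proof (rule injI, rule ccontr)
    fix a b assume ab: "\<phi> a = \<phi> b" "a \<noteq> b"
    \<comment> \<open>The coefficients make the inner product of \<open>W f\<close> with
      \<open>g\<close> equal to \<open>\<psi> b * \<psi> a * (f (\<phi> a) - f (\<phi> b))\<close>,
      which is zero.\<close>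
    define g where "g = (\<lambda>z. cnj (\<psi> b) * fock_kernel a z - cnj (\<psi> a) * fock_kernel b z)"
    have "g = (\<lambda>z. 0)"
    proof (rule ker)
      show "g \<in> fock_space"
        unfolding g_def by (intro fock_space_diff fock_space_cmult fock_kernel_in_fock_space)
      show "fock_inner (W f) g = 0" if "f \<in> D" for f
        unfolding g_def using that ab(1)
        by (subst fock_inner_diff_right)
           (simp_all add: WD fock_space_cmult fock_kernel_in_fock_space fock_inner_cmult_right WK)
    qed
    then have g0: "g z = 0" for z by simp
    \<comment> \<open>Both kernels equal \<open>1\<close> at the origin.\<close>
    have "\<psi> b = \<psi> a" using g0[of 0] by (simp add: g_def fock_kernel_def flip: complex_cnj_diff)
    then have eq: "exp (cnj a * z) = exp (cnj b * z)" for z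
      using g0[of z] psi_nz[of a] by (simp add: g_def fock_kernel_def)
    \<comment> \<open>At this point the two exponents differ by exactly \<open>1\<close>.\<close>
    define z where "z = 1 / (cnj a - cnj b)"
    have "cnj a * z - cnj b * z = 1"
      using ab(2) by (simp add: z_def flip: diff_divide_distrib)
    then have "exp 1 = exp (cnj a * z) / exp (cnj b * z)"
      by (metis exp_diff)
    also have "\<dots> = 1" by (simp add: eq)
    finally have "cmod (exp 1) = 1" by simp
    then show False by (simp add: norm_exp_eq_Re)
  qed
  then obtain A B where AB: "A \<noteq> 0" "\<And>z. \<phi> z = A * z + B"
    using injective_entire_imp_affine[OF assms(3)] by blast
  have part3: "\<exists>E. \<psi> 0 \<noteq> 0 \<and> (\<forall>z. \<psi> z = \<psi> 0 * exp (E * z)) \<and> cmod E \<le> cmod B"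
    if A1: "A = 1" and Sid: "\<forall>f\<in>fock_space. S f = f"
  proof -
    have phi: "\<phi> z = z + B" for z using AB A1 by simp
    have WKD: "fock_kernel w \<in> D"
      and WKle: "fock_norm (W (fock_kernel w)) \<le> cmod (\<psi> w) * exp ((cmod (w + B))\<^sup>2 / 2)" for w
    proof -
      have "fock_inner (W f) (fock_kernel w) = fock_inner f (\<lambda>z. cnj (\<psi> w) * fock_kernel (\<phi> w) z)"
        if "f \<in> D" for f
        using that Dfock by (simp add: WK fock_inner_cmult_right fock_reproducing subset_iff)
      from key[OF fock_kernel_in_fock_space fock_space_cmult[OF fock_kernel_in_fock_space] this]
      show "fock_kernel w \<in> D"
        "fock_norm (W (fock_kernel w)) \<le> cmod (\<psi> w) * exp ((cmod (w + B))\<^sup>2 / 2)"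
        using Sid by (simp_all add: fock_kernel_in_fock_space fock_norm_cmult fock_norm_kernel phi)
    qed
    \<comment> \<open>The kernel at \<open>0\<close> is the constant \<open>1\<close> and lies in
      \<open>D\<close>, so \<open>\<psi>\<close> is in the Fock space and has the Gaussian
      form.\<close>
    have "W (fock_kernel 0) = \<psi>"
      by (simp add: W_def wcomp_def fock_kernel_def)
    then have "\<psi> \<in> fock_space" using WD[OF WKD[of 0]] by simp
    then obtain C E where CE: "\<And>z. \<psi> z = \<psi> 0 * exp (C * z\<^sup>2 + E * z)"
      using psi_form by blast
    have ineq: "Re (2 * C * w * h + C * h\<^sup>2 + E * h) - (cmod h)\<^sup>2 / 2 \<le> (cmod B)\<^sup>2 / 2" for w h
    proof -
      define u where "u = w + h"
      have "cmod (W (fock_kernel w) u) \<le> fock_norm (W (fock_kernel w)) * exp ((cmod u)\<^sup>2 / 2)"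
        by (rule fock_pointwise_bound[OF WD[OF WKD]])
      also have "\<dots> \<le> cmod (\<psi> w) * exp ((cmod (w + B))\<^sup>2 / 2) * exp ((cmod u)\<^sup>2 / 2)"
        by (intro mult_right_mono WKle) simp
      finally have "cmod (\<psi> 0) * exp (Re (C * u\<^sup>2 + E * u) + Re (cnj w * (u + B))) \<le>
         cmod (\<psi> 0) * exp (Re (C * w\<^sup>2 + E * w) + (cmod (w + B))\<^sup>2 / 2 + (cmod u)\<^sup>2 / 2)"
        unfolding W_def wcomp_def fock_kernel_def phi CE[of u] CE[of w] norm_mult norm_exp_eq_Re
        by (simp only: exp_add mult.assoc)
      then have le: "Re (C * u\<^sup>2 + E * u) + Re (cnj w * (u + B)) \<le>
          Re (C * w\<^sup>2 + E * w) + (cmod (w + B))\<^sup>2 / 2 + (cmod u)\<^sup>2 / 2"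
        using psi_nz[of 0] by simp
      have "C * u\<^sup>2 + E * u = (C * w\<^sup>2 + E * w) + (2 * C * w * h + C * h\<^sup>2 + E * h)"
        by (simp add: u_def power2_eq_square algebra_simps)
      then have 1: "Re (C * u\<^sup>2 + E * u) = Re (C * w\<^sup>2 + E * w) + Re (2 * C * w * h + C * h\<^sup>2 + E * h)"
        by (metis plus_complex.sel(1))
      \<comment> \<open>Polarisation for the pairs \<open>w\<close>, \<open>B\<close> and
        \<open>w\<close>, \<open>u\<close>, using \<open>h = u - w\<close>; the squares of
        \<open>cmod w\<close> cancel.\<close>
      have 2: "Re (cnj w * (u + B)) = (cmod (w + B))\<^sup>2 / 2 + (cmod u)\<^sup>2 / 2 - (cmod h)\<^sup>2 / 2 - (cmod B)\<^sup>2 / 2"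
        unfolding u_def cmod_power2 by (simp add: power2_eq_square field_simps)
      from le show ?thesis unfolding 1 2 by linarith
    qed
    have "C = 0"
    proof (rule ccontr)
      assume "C \<noteq> 0"
      \<comment> \<open>For \<open>h = 1\<close> and \<open>2 * C * w = t\<close> the left side of
        \<open>ineq\<close> becomes \<open>(cmod B)\<^sup>2 / 2 + 1\<close>, exceeding the right
        side by \<open>1\<close>.\<close>
      define t where "t = (cmod B)\<^sup>2 / 2 + 1 - Re (C + E) + 1 / 2"
      have "2 * C * (of_real t / (2 * C)) = of_real t" using \<open>C \<noteq> 0\<close> by simp
      with ineq[of "of_real t / (2 * C)" 1] show False by (simp add: t_def)
    qed
    \<comment> \<open>With \<open>C = 0\<close> the left side of \<open>ineq\<close> is
      \<open>Re (E * h) - (cmod h)\<^sup>2 / 2\<close>, maximal at \<open>h = cnj E\<close> with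
      value \<open>(cmod E)\<^sup>2 / 2\<close>.\<close>
    have "E * cnj E = complex_of_real ((cmod E)\<^sup>2)" by (simp only: complex_norm_square)
    then have "(cmod E)\<^sup>2 \<le> (cmod B)\<^sup>2"
      using ineq[of 0 "cnj E"] \<open>C = 0\<close> by simp
    then have "cmod E \<le> cmod B" by (rule power2_le_imp_le) simp
    moreover have "\<psi> z = \<psi> 0 * exp (E * z)" for z using CE[of z] \<open>C = 0\<close> by simp
    ultimately show ?thesis using psi_nz by blast
  qed
  show ?thesis
    using psi_nz psi_form AB part3 by blast
qed

end
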